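(* Let $G$ be a group that contains a nonabelian free subgroup. Then there is a left-invariant partial order $\prec$ on $G$ such that $\mathrm{Ext}(\prec)$ does not carry a $G$-invariant Borel probability measure.
   Context: A partial order on a set is a transitive, antisymmetric ($x\prec y$ implies not $y\prec x$), antireflexive relation; it is total if any two distinct elements are comparable. $\mathrm{pOrd}(G)$ is the set of partial orders on $G$, viewed as a subset of $2^{G\times G}$ with the product topology. For a partial order $\prec$ on $G$, $\mathrm{Ext}(\prec)$ is the set of all total orders on $G$ that contain $\prec$. $G$ acts on orders by the L-action: $x\,(g\prec)\,y$ iff $g^{-1}x\prec g^{-1}y$. An order is left-invariant if it is fixed by the L-action; then $\mathrm{Ext}(\prec)$ is invariant under the L-action, and invariance of measures on $\mathrm{Ext}(\prec)$ is with respect to this action. *)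

theory Defs
  imports "HOL-Probability.Probability_Measure" "HOL-Algebra.Group"
begin

subsection \<open>Free groups\<close>

text \<open>A letter \<open>(x, True)\<close> stands for \<open>x\<close> and \<open>(x, False)\<close> for its inverse.\<close>

definition reduced_words :: "'a set \<Rightarrow> ('a \<times> bool) list set" where
  "reduced_words S =
     {w. fst ` set w \<subseteq> S \<and> successively (\<lambda>p q. \<not> (fst p = fst q \<and> snd p \<noteq> snd q)) w}"

definition word_value :: "('a, 'b) monoid_scheme \<Rightarrow> ('a \<times> bool) list \<Rightarrow> 'a" where
  "word_value G w =
     foldr (\<lambda>(x, e) y. (if e then x else inv\<^bsub>G\<^esub> x) \<otimes>\<^bsub>G\<^esub> y) w \<one>\<^bsub>G\<^esub>"

definition freely_generates :: "('a, 'b) monoid_scheme \<Rightarrow> 'a set \<Rightarrow> bool" where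
  "freely_generates G S \<longleftrightarrow>
     S \<subseteq> carrier G \<and> bij_betw (word_value G) (reduced_words S) (carrier G)"

definition free_group :: "('a, 'b) monoid_scheme \<Rightarrow> bool" where
  "free_group G \<longleftrightarrow> group G \<and> (\<exists>S. freely_generates G S)"


subsection \<open>Orders\<close>

text \<open>
  Relations on a set \<open>A\<close> are curried predicates that vanish outside \<open>A \<times> A\<close>. With \<open>bool\<close>
  discrete, the topology of \<open>'a \<Rightarrow> 'a \<Rightarrow> bool\<close> is the product topology (see
  \<open>homeomorphism_curry\<close> below), and the subspace of relations on \<open>A\<close> is \<open>2\<close> to the \<open>A \<times> A\<close>.
\<close>

lemma homeomorphism_curry:
  "homeomorphism UNIV UNIV
     (curry :: ('a \<times> 'b \<Rightarrow> 'c::topological_space) \<Rightarrow> 'a \<Rightarrow> 'b \<Rightarrow> 'c) case_prod"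
proof (rule homeomorphismI)
  show "continuous_on UNIV (curry :: ('a \<times> 'b \<Rightarrow> 'c) \<Rightarrow> 'a \<Rightarrow> 'b \<Rightarrow> 'c)"
    unfolding curry_def by (intro continuous_on_coordinatewise_then_product) simp
  have "continuous_on UNIV (\<lambda>f :: 'a \<Rightarrow> 'b \<Rightarrow> 'c. f a b)" for a b
    by (rule continuous_on_product_then_coordinatewise[where f = "\<lambda>f. f a"]) simp
  then show "continuous_on UNIV (case_prod :: ('a \<Rightarrow> 'b \<Rightarrow> 'c) \<Rightarrow> 'a \<times> 'b \<Rightarrow> 'c)"
    by (intro continuous_on_coordinatewise_then_product) (simp add: split_beta)
qed auto

definition pOrd :: "'a set \<Rightarrow> ('a \<Rightarrow> 'a \<Rightarrow> bool) set" where
  "pOrd A =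
     {r. (\<forall>x y. r x y \<longrightarrow> x \<in> A \<and> y \<in> A) \<and> transp_on A r \<and> asymp_on A r \<and> irreflp_on A r}"

definition Ext :: "'a set \<Rightarrow> ('a \<Rightarrow> 'a \<Rightarrow> bool) \<Rightarrow> ('a \<Rightarrow> 'a \<Rightarrow> bool) set" where
  "Ext A r = {s \<in> pOrd A. totalp_on A s \<and> r \<le> s}"

definition L_action ::
  "('a, 'b) monoid_scheme \<Rightarrow> 'a \<Rightarrow> ('a \<Rightarrow> 'a \<Rightarrow> bool) \<Rightarrow> 'a \<Rightarrow> 'a \<Rightarrow> bool" where
  "L_action G g r = (\<lambda>x y. x \<in> carrier G \<and> y \<in> carrier G \<and>
     r (inv\<^bsub>G\<^esub> g \<otimes>\<^bsub>G\<^esub> x) (inv\<^bsub>G\<^esub> g \<otimes>\<^bsub>G\<^esub> y))"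

definition left_invariant :: "('a, 'b) monoid_scheme \<Rightarrow> ('a \<Rightarrow> 'a \<Rightarrow> bool) \<Rightarrow> bool" where
  "left_invariant G r \<longleftrightarrow> (\<forall>g\<in>carrier G. L_action G g r = r)"


subsection \<open>Invariant measures\<close>

definition borel_prob_on :: "'x::topological_space set \<Rightarrow> 'x measure \<Rightarrow> bool" where
  "borel_prob_on X M \<longleftrightarrow> prob_space M \<and> sets M = sets (restrict_space borel X)"

definition L_invariant_measure ::
  "('a, 'b) monoid_scheme \<Rightarrow> ('a \<Rightarrow> 'a \<Rightarrow> bool) measure \<Rightarrow> bool" where
  "L_invariant_measure G M \<longleftrightarrow>
     (\<forall>g\<in>carrier G. \<forall>E\<in>sets M. emeasure M (L_action G g ` E) = emeasure M E)"

end

theory Submission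
  imports Defs
begin

text \<open>
  For an invariant random total order \<open><\<close>, let \<open>p(y)\<close> be the probability of \<open>\<one> < y\<close>. Invariance
  makes it the probability of \<open>x < x y\<close> for every \<open>x\<close>, and gives \<open>p(y) + p(y\<inverse>) = 1\<close> for
  \<open>y \<noteq> \<one>\<close>. The partial order is chosen so that \<open>p(y) \<le> 1/3\<close> for both \<open>y = b\<close> and
  \<open>y = b\<inverse>\<close>, where \<open>a\<close> and \<open>b\<close> are two of the free generators, which is a contradiction.

  To bound \<open>p(y)\<close>, it suffices that \<open>a\<^sup>i y \<prec> a\<^sup>j\<close> for all distinct \<open>i, j\<close> in \<open>{0, 1, 2}\<close>: then
  \<open>a\<^sup>i < a\<^sup>i y\<close> and \<open>a\<^sup>j < a\<^sup>j y\<close> exclude each other, as they would give the cycle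
  \<open>a\<^sup>i < a\<^sup>i y < a\<^sup>j < a\<^sup>j y < a\<^sup>i\<close>; so three events of probability \<open>p(y)\<close> are disjoint
  (\<open>exclusive_events_bound\<close>).

  A left-invariant order with these relations must have the positive cone contain the elements
  \<open>b\<^sup>\<plusminus>\<^sup>1 a\<^sup>k\<close>, \<open>0 < \<bar>k\<bar> \<le> 2\<close>. All of them are values of reduced words that begin with
  \<open>b\<^sup>\<plusminus>\<^sup>1\<close> and end with \<open>a\<^sup>\<plusminus>\<^sup>1\<close>. Nothing cancels when such words are concatenated, so
  their values form a semigroup, which by freeness does not contain \<open>\<one>\<close>. In an abelian group
  this fails, since the product of \<open>b a\<close> and \<open>b\<inverse> a\<inverse>\<close> is \<open>\<one>\<close>.
\<close>

section \<open>Left-invariant orders and positive cones\<close>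

definition cone_order :: "('a, 'b) monoid_scheme \<Rightarrow> 'a set \<Rightarrow> 'a \<Rightarrow> 'a \<Rightarrow> bool" where
  "cone_order G P x y \<longleftrightarrow> x \<in> carrier G \<and> y \<in> carrier G \<and> inv\<^bsub>G\<^esub> x \<otimes>\<^bsub>G\<^esub> y \<in> P"

lemma (in group) inv_cancel_left:
  assumes "x \<in> carrier G" "y \<in> carrier G"
  shows "x \<otimes> (inv x \<otimes> y) = y" "inv x \<otimes> (x \<otimes> y) = y"
  using assms by (simp_all flip: m_assoc)

lemma (in group) inv_translate_mult:
  assumes "g \<in> carrier G" "x \<in> carrier G" "y \<in> carrier G"
  shows "inv (g \<otimes> x) \<otimes> (g \<otimes> y) = inv x \<otimes> y"
  using assms by (simp add: inv_mult_group m_assoc inv_cancel_left)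

lemma (in group) cone_order_left_invariant: "left_invariant G (cone_order G P)"
  unfolding left_invariant_def L_action_def cone_order_def
  by (auto simp: fun_eq_iff inv_translate_mult)

lemma (in group) cone_order_in_pOrd:
  assumes mult: "\<And>x y. x \<in> P \<Longrightarrow> y \<in> P \<Longrightarrow> x \<otimes> y \<in> P" and one: "\<one> \<notin> P"
  shows "cone_order G P \<in> pOrd (carrier G)"
proof -
  have trans: "cone_order G P x z" if "cone_order G P x y" "cone_order G P y z" for x y z
  proof -
    have "inv x \<otimes> z = (inv x \<otimes> y) \<otimes> (inv y \<otimes> z)"
      using that by (simp add: cone_order_def m_assoc inv_cancel_left)
    then show ?thesis
      using that mult by (simp add: cone_order_def)
  qed
  have irrefl: "\<not> cone_order G P x x" for x
    using one by (auto simp: cone_order_def)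
  have "transp_on (carrier G) (cone_order G P)"
    using trans by (intro transp_onI)
  moreover have "asymp_on (carrier G) (cone_order G P)"
    using trans irrefl by (intro asymp_onI) blast
  moreover have "irreflp_on (carrier G) (cone_order G P)"
    using irrefl by (intro irreflp_onI)
  moreover have "x \<in> carrier G \<and> y \<in> carrier G" if "cone_order G P x y" for x y
    using that by (simp add: cone_order_def)
  ultimately show ?thesis
    by (simp add: pOrd_def)
qed


section \<open>Invariant measures on the total extensions\<close>

definition ext_event ::
  "('a, 'b) monoid_scheme \<Rightarrow> ('a \<Rightarrow> 'a \<Rightarrow> bool) \<Rightarrow> 'a \<Rightarrow> 'a \<Rightarrow> ('a \<Rightarrow> 'a \<Rightarrow> bool) set" where
  "ext_event G r x y = {s \<in> Ext (carrier G) r. s x y}"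

lemma (in group) L_action_in_Ext:
  assumes r: "left_invariant G r" and g: "g \<in> carrier G" and s: "s \<in> Ext (carrier G) r"
  shows "L_action G g s \<in> Ext (carrier G) r"
proof -
  have cl: "inv g \<otimes> x \<in> carrier G" if "x \<in> carrier G" for x
    using g that by simp
  have inj: "inv g \<otimes> x \<noteq> inv g \<otimes> y" if "x \<in> carrier G" "y \<in> carrier G" "x \<noteq> y" for x y
    using g that by simp
  have s': "transp_on (carrier G) s" "asymp_on (carrier G) s" "irreflp_on (carrier G) s"
    "totalp_on (carrier G) s" "r \<le> s"
    using s by (auto simp: Ext_def pOrd_def)
  have "r = L_action G g r"
    using r g by (simp add: left_invariant_def)
  also have "\<dots> \<le> L_action G g s"
    using \<open>r \<le> s\<close> by (auto simp: L_action_def le_fun_def)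
  finally have "r \<le> L_action G g s" .
  moreover have "transp_on (carrier G) (L_action G g s)"
    by (rule transp_onI) (use s'(1) cl in \<open>auto simp: L_action_def dest: transp_onD\<close>)
  moreover have "asymp_on (carrier G) (L_action G g s)"
    by (rule asymp_onI) (use s'(2) cl in \<open>auto simp: L_action_def dest: asymp_onD\<close>)
  moreover have "irreflp_on (carrier G) (L_action G g s)"
    by (rule irreflp_onI) (use s'(3) cl in \<open>auto simp: L_action_def dest: irreflp_onD\<close>)
  moreover have "totalp_on (carrier G) (L_action G g s)"
    by (rule totalp_onI) (use s'(4) cl inj in \<open>auto simp: L_action_def dest: totalp_onD\<close>)
  ultimately show ?thesis
    by (auto simp: Ext_def pOrd_def L_action_def)
qed

lemma (in group) L_action_inv_cancel:
  assumes "g \<in> carrier G" "s \<in> Ext (carrier G) r"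
  shows "L_action G g (L_action G (inv g) s) = s"
  using assms
  by (auto simp: L_action_def Ext_def pOrd_def fun_eq_iff m_assoc[symmetric])

lemma (in group) L_action_image_ext_event:
  assumes r: "left_invariant G r"
    and g: "g \<in> carrier G" and x: "x \<in> carrier G" and y: "y \<in> carrier G"
  shows "L_action G g ` ext_event G r x y = ext_event G r (g \<otimes> x) (g \<otimes> y)"
proof (intro equalityI subsetI)
  fix t assume "t \<in> L_action G g ` ext_event G r x y"
  then obtain s where s: "s \<in> Ext (carrier G) r" "s x y" and t: "t = L_action G g s"
    by (auto simp: ext_event_def)
  then have "t (g \<otimes> x) (g \<otimes> y)"
    using g x y by (simp add: L_action_def m_assoc[symmetric])
  then show "t \<in> ext_event G r (g \<otimes> x) (g \<otimes> y)"
    using L_action_in_Ext[OF r g s(1)] t by (simp add: ext_event_def)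
next
  fix t assume t: "t \<in> ext_event G r (g \<otimes> x) (g \<otimes> y)"
  let ?s = "L_action G (inv g) t"
  have "?s \<in> ext_event G r x y"
    using t g x y L_action_in_Ext[OF r, of "inv g" t] by (simp add: ext_event_def L_action_def)
  moreover have "t = L_action G g ?s"
    using t L_action_inv_cancel[OF g, of t r] by (simp add: ext_event_def)
  ultimately show "t \<in> L_action G g ` ext_event G r x y"
    by blast
qed

lemma space_borel_prob_on: "borel_prob_on X M \<Longrightarrow> space M = X"
  by (auto simp: borel_prob_on_def space_restrict_space dest: sets_eq_imp_space_eq)

lemma ext_event_sets:
  assumes "borel_prob_on (Ext (carrier G) r) M"
  shows "ext_event G r x y \<in> sets M"
proof -
  have "continuous_on UNIV (\<lambda>s :: 'a \<Rightarrow> 'a \<Rightarrow> bool. s x y)"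
    by (rule continuous_on_product_then_coordinatewise[where f = "\<lambda>s. s x"]) simp
  then have "open ((\<lambda>s :: 'a \<Rightarrow> 'a \<Rightarrow> bool. s x y) -` {True})"
    by (intro open_vimage) (auto intro: open_discrete)
  then have "(\<lambda>s. s x y) -` {True} \<in> sets (borel :: ('a \<Rightarrow> 'a \<Rightarrow> bool) measure)"
    by (rule borel_open)
  then have "Ext (carrier G) r \<inter> (\<lambda>s. s x y) -` {True} \<in> sets M"
    using assms by (auto simp: borel_prob_on_def sets_restrict_space)
  moreover have "Ext (carrier G) r \<inter> (\<lambda>s. s x y) -` {True} = ext_event G r x y"
    by (auto simp: ext_event_def)
  ultimately show ?thesis
    by simp
qed

lemma (in group) ext_event_translate:
  assumes M: "borel_prob_on (Ext (carrier G) r) M" "L_invariant_measure G M"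
    and r: "left_invariant G r"
    and "g \<in> carrier G" "x \<in> carrier G" "y \<in> carrier G"
  shows "measure M (ext_event G r (g \<otimes> x) (g \<otimes> y)) = measure M (ext_event G r x y)"
  using M(2) ext_event_sets[OF M(1), of x y] assms(4-6)
  by (simp add: measure_def L_invariant_measure_def flip: L_action_image_ext_event[OF r])

lemma (in group) ext_event_inv:
  assumes M: "borel_prob_on (Ext (carrier G) r) M" "L_invariant_measure G M"
    and r: "left_invariant G r" and y: "y \<in> carrier G" "y \<noteq> \<one>"
  shows "measure M (ext_event G r \<one> y) + measure M (ext_event G r \<one> (inv y)) = 1"
proof -
  interpret prob_space M
    using M(1) by (simp add: borel_prob_on_def)
  have "measure M (ext_event G r \<one> (inv y)) = measure M (ext_event G r y \<one>)"
    using ext_event_translate[OF M r, of "inv y" y \<one>] y by simp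
  moreover have "ext_event G r \<one> y \<inter> ext_event G r y \<one> = {}"
    using y by (auto simp: ext_event_def Ext_def pOrd_def dest: asymp_onD)
  moreover have "ext_event G r \<one> y \<union> ext_event G r y \<one> = space M"
    using y unfolding space_borel_prob_on[OF M(1)]
    by (auto simp: ext_event_def Ext_def dest: totalp_onD)
  ultimately show ?thesis
    using finite_measure_Union[OF ext_event_sets[OF M(1)] ext_event_sets[OF M(1)]] prob_space
    by metis
qed

text \<open>
  All the events \<open>u i < u i \<otimes> y\<close> have the probability of \<open>\<one> < y\<close>. No two of them happen in the
  same extension \<open>s\<close> of \<open>r\<close>, since then \<open>u i\<close>, \<open>u i \<otimes> y\<close>, \<open>u j\<close>, \<open>u j \<otimes> y\<close> form a cycle.
\<close>
lemma (in group) exclusive_events_bound: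
  assumes M: "borel_prob_on (Ext (carrier G) r) M" "L_invariant_measure G M"
    and r: "left_invariant G r"
    and y: "y \<in> carrier G" and u: "\<And>i. i \<in> I \<Longrightarrow> u i \<in> carrier G" and I: "finite I"
    and rel: "\<And>i j. i \<in> I \<Longrightarrow> j \<in> I \<Longrightarrow> i \<noteq> j \<Longrightarrow> r (u i \<otimes> y) (u j)"
  shows "real (card I) * measure M (ext_event G r \<one> y) \<le> 1"
proof -
  interpret prob_space M
    using M(1) by (simp add: borel_prob_on_def)
  let ?E = "\<lambda>i. ext_event G r (u i) (u i \<otimes> y)"
  have "disjoint_family_on ?E I"
  proof (unfold disjoint_family_on_def, intro ballI impI equals0I)
    fix i j s assume ij: "i \<in> I" "j \<in> I" "i \<noteq> j" and s: "s \<in> ?E i \<inter> ?E j"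
    have tr: "transp_on (carrier G) s" and ir: "irreflp_on (carrier G) s" and "r \<le> s"
      using s by (auto simp: ext_event_def Ext_def pOrd_def)
    have c: "u i \<in> carrier G" "u j \<in> carrier G" "u i \<otimes> y \<in> carrier G" "u j \<otimes> y \<in> carrier G"
      using ij u y by auto
    have "s (u i) (u i \<otimes> y)" "s (u i \<otimes> y) (u j)" "s (u j) (u j \<otimes> y)" "s (u j \<otimes> y) (u i)"
      using s rel ij \<open>r \<le> s\<close> by (auto simp: ext_event_def le_fun_def)
    then have "s (u i) (u i)"
      using transp_onD[OF tr] c by meson
    then show False
      using irreflp_onD[OF ir] c by blast
  qed
  then have "measure M (\<Union>i\<in>I. ?E i) = (\<Sum>i\<in>I. measure M (?E i))"
    using I ext_event_sets[OF M(1)] by (intro finite_measure_finite_Union) auto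
  also have "\<dots> = (\<Sum>i\<in>I. measure M (ext_event G r \<one> y))"
    using ext_event_translate[OF M r, of "u _" \<one> y] u y by (intro sum.cong) auto
  finally show ?thesis
    using prob_le_1[of "\<Union>i\<in>I. ?E i"] by simp
qed


section \<open>Values of reduced words\<close>

lemma (in group) word_value_closed:
  "fst ` set w \<subseteq> carrier G \<Longrightarrow> word_value G w \<in> carrier G"
  by (induction w) (auto simp: word_value_def split: prod.split)

lemma (in group) word_value_append:
  "fst ` set v \<subseteq> carrier G \<Longrightarrow> fst ` set w \<subseteq> carrier G \<Longrightarrow>
    word_value G (v @ w) = word_value G v \<otimes> word_value G w"
proof (induction v)
  case Nil
  then show ?case
    using word_value_closed[of w] by (simp add: word_value_def)
next
  case (Cons p v)
  then show ?case
    using word_value_closed[of v] word_value_closed[of w]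
    by (cases p) (auto simp: word_value_def m_assoc)
qed

lemma (in group) word_value_replicate:
  assumes "x \<in> carrier G"
  shows "word_value G (replicate n (x, e)) = (if e then x else inv x) [^] n"
proof (induction n)
  case (Suc n)
  then show ?case
    using assms nat_pow_Suc2[of "if e then x else inv x" n] by (auto simp: word_value_def)
qed (simp add: word_value_def)

lemma (in group) commutes_word_value:
  assumes y: "y \<in> carrier G"
  shows "fst ` set w \<subseteq> carrier G \<Longrightarrow> (\<And>x. x \<in> fst ` set w \<Longrightarrow> x \<otimes> y = y \<otimes> x) \<Longrightarrow>
    word_value G w \<otimes> y = y \<otimes> word_value G w"
proof (induction w)
  case Nil
  then show ?case
    using y by (simp add: word_value_def)
next
  case (Cons p w)
  obtain x e where p: "p = (x, e)"
    by fastforce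
  define z where "z = (if e then x else inv x)"
  have x: "x \<in> carrier G" and xy: "x \<otimes> y = y \<otimes> x"
    using Cons.prems(1) Cons.prems(2)[of x] p by auto
  have w: "word_value G w \<in> carrier G"
    using Cons.prems(1) by (intro word_value_closed) auto
  have z: "z \<in> carrier G"
    using x by (simp add: z_def)
  have "inv x \<otimes> y = y \<otimes> inv x"
  proof -
    have "inv x \<otimes> y = inv x \<otimes> (y \<otimes> x) \<otimes> inv x"
      using x y by (simp add: m_assoc)
    also have "\<dots> = y \<otimes> inv x"
      using x y by (simp add: m_assoc[symmetric] flip: xy)
    finally show ?thesis .
  qed
  then have zy: "z \<otimes> y = y \<otimes> z"
    using xy by (simp add: z_def)
  have "word_value G (p # w) \<otimes> y = z \<otimes> (word_value G w \<otimes> y)"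
    using w y z by (simp add: word_value_def p m_assoc flip: z_def)
  also have "word_value G w \<otimes> y = y \<otimes> word_value G w"
    using Cons.prems by (intro Cons.IH) auto
  also have "z \<otimes> (y \<otimes> word_value G w) = y \<otimes> (z \<otimes> word_value G w)"
    using w y z zy by (metis m_assoc)
  finally show ?case
    by (simp add: word_value_def p flip: z_def)
qed

text \<open>
  If all generators commute, then each generator commutes with all words, and so each element does.
\<close>
lemma (in group) noncommuting_free_generators:
  assumes S: "freely_generates G S" and nc: "\<not> comm_group G"
  obtains a b where "a \<in> S" "b \<in> S" "a \<otimes> b \<noteq> b \<otimes> a"
proof -
  have SG: "S \<subseteq> carrier G"
    using S by (simp add: freely_generates_def)
  have gen: "\<exists>w. fst ` set w \<subseteq> S \<and> x = word_value G w" if "x \<in> carrier G" for x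
  proof -
    have "x \<in> word_value G ` reduced_words S"
      using S that by (simp add: freely_generates_def bij_betw_def)
    then show ?thesis
      by (auto simp: reduced_words_def)
  qed
  have False if comm: "\<And>a b. a \<in> S \<Longrightarrow> b \<in> S \<Longrightarrow> a \<otimes> b = b \<otimes> a"
  proof -
    have gen_comm: "x \<otimes> a = a \<otimes> x" if a: "a \<in> S" and x: "x \<in> carrier G" for a x
    proof -
      obtain w where w: "fst ` set w \<subseteq> S" "x = word_value G w"
        using gen[OF x] by blast
      show ?thesis
        unfolding w(2) by (rule commutes_word_value) (use w(1) a SG comm in blast)+
    qed
    have "x \<otimes> y = y \<otimes> x" if x: "x \<in> carrier G" and y: "y \<in> carrier G" for x y
    proof -
      obtain w where w: "fst ` set w \<subseteq> S" "x = word_value G w"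
        using gen[OF x] by blast
      show ?thesis
        unfolding w(2) by (rule commutes_word_value)
          (use w(1) y SG gen_comm[OF _ y] in \<open>auto simp: subset_iff\<close>)
    qed
    then have "comm_group G"
      by (intro group_comm_groupI)
    then show False
      using nc by blast
  qed
  then show thesis
    using that by blast
qed


section \<open>The cone of a pair of free generators\<close>

definition cone_words :: "'a \<Rightarrow> 'a \<Rightarrow> ('a \<times> bool) list set" where
  "cone_words a b =
     {w \<in> reduced_words {a, b}. w \<noteq> [] \<and> fst (hd w) = b \<and> fst (last w) = a}"

text \<open>
  At the junction of two such words a letter \<open>a\<^sup>\<plusminus>\<^sup>1\<close> meets a letter \<open>b\<^sup>\<plusminus>\<^sup>1\<close>, so the
  concatenation is already reduced.
\<close>
lemma cone_words_append:
  assumes "a \<noteq> b" "v \<in> cone_words a b" "w \<in> cone_words a b"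
  shows "v @ w \<in> cone_words a b"
  using assms by (auto simp: cone_words_def reduced_words_def successively_append_iff)

lemma cone_words_replicate:
  assumes "a \<noteq> b" "n > 0"
  shows "(b, e) # replicate n (a, d) \<in> cone_words a b"
proof -
  have "successively (\<lambda>p q. \<not> (fst p = fst q \<and> snd p \<noteq> snd q)) (replicate n (a, d))"
    by (simp add: successively_conv_nth)
  then show ?thesis
    using assms by (auto simp: cone_words_def reduced_words_def successively_Cons hd_replicate)
qed

text \<open>
  The exponents of \<open>b\<close> and \<open>a\<close> may have any signs: a cone containing both \<open>b a\<^sup>n\<close> and
  \<open>b\<inverse> a\<^sup>n\<close> makes the bound on \<open>p(y)\<close> available for \<open>y = b\<close> and \<open>y = b\<inverse>\<close> at once, and
  containing \<open>a\<^sup>n\<close> and \<open>a\<^sup>-\<^sup>n\<close> after them makes the events exclude each other symmetrically.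
  Injectivity on reduced words keeps \<open>\<one>\<close>, the value of the empty word, out of the cone.
\<close>
lemma (in group) free_cone:
  assumes S: "freely_generates G S" and a: "a \<in> S" and b: "b \<in> S" and ab: "a \<noteq> b"
  defines "P \<equiv> word_value G ` cone_words a b"
  shows "\<And>x y. x \<in> P \<Longrightarrow> y \<in> P \<Longrightarrow> x \<otimes> y \<in> P" and "\<one> \<notin> P"
    and "\<And>y n. y \<in> {b, inv b} \<Longrightarrow> n > 0 \<Longrightarrow> y \<otimes> a [^] (n::nat) \<in> P"
    and "\<And>y n. y \<in> {b, inv b} \<Longrightarrow> n > 0 \<Longrightarrow> y \<otimes> inv a [^] (n::nat) \<in> P"
proof -
  have SG: "S \<subseteq> carrier G" and inj: "inj_on (word_value G) (reduced_words S)"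
    using S by (auto simp: freely_generates_def bij_betw_def)
  have cone_S: "cone_words a b \<subseteq> reduced_words S"
    using a b by (auto simp: cone_words_def reduced_words_def)
  then have letters: "fst ` set w \<subseteq> carrier G" if "w \<in> cone_words a b" for w
    using that SG by (fastforce simp: reduced_words_def)
  show "x \<otimes> y \<in> P" if "x \<in> P" "y \<in> P" for x y
    using that cone_words_append[OF ab] letters unfolding P_def
    by (auto simp flip: word_value_append)
  show "\<one> \<notin> P"
  proof
    assume "\<one> \<in> P"
    then obtain w where w: "w \<in> cone_words a b" "word_value G w = word_value G []"
      by (auto simp: P_def word_value_def)
    moreover have "[] \<in> reduced_words S"
      by (simp add: reduced_words_def)
    ultimately have "w = []"
      using inj_onD[OF inj w(2)] cone_S by blast
    then show False
      using w by (simp add: cone_words_def)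
  qed
  have *: "(if e then b else inv b) \<otimes> (if d then a else inv a) [^] n \<in> P" if "n > 0" for e d and n :: nat
  proof -
    have "word_value G ((b, e) # replicate n (a, d)) \<in> P"
      using cone_words_replicate[OF ab that] by (simp add: P_def)
    moreover have "word_value G ((b, e) # replicate n (a, d)) =
        (if e then b else inv b) \<otimes> word_value G (replicate n (a, d))"
      by (simp add: word_value_def)
    ultimately show ?thesis
      using word_value_replicate[of a n d] a SG by auto
  qed
  show "y \<otimes> a [^] n \<in> P" "y \<otimes> inv a [^] n \<in> P" if "y \<in> {b, inv b}" "n > 0" for y and n :: nat
    using that *[of n True True] *[of n False True] *[of n True False] *[of n False False] by auto
qed

lemma (in group) inv_pow_mult_pow:
  assumes x: "x \<in> carrier G"
  shows "inv (x [^] i) \<otimes> x [^] j = (if i \<le> j then x [^] (j - i) else inv x [^] (i - j :: nat))"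
proof -
  have "inv (x [^] i) \<otimes> x [^] j = x [^] (int j - int i)"
    using x by (simp add: int_pow_diff flip: int_pow_int)
       (metis add.commute diff_conv_add_uminus int_pow_int int_pow_mult int_pow_neg x)
  also have "\<dots> = (if i \<le> j then x [^] (j - i) else inv x [^] (i - j))"
  proof (cases "i \<le> j")
    case True
    then have "int j - int i = int (j - i)"
      by simp
    then show ?thesis
      using True by (simp only: int_pow_int if_True)
  next
    case False
    then have "int j - int i = - int (i - j)"
      by simp
    then show ?thesis
      using False x by (simp only: int_pow_neg_int nat_pow_inv if_False)
  qed
  finally show ?thesis .
qed


section \<open>An order without invariant measures on its extensions\<close>

lemma (in group) no_invariant_measure_of_free_subgroup:
  assumes H: "subgroup H G" and free: "free_group (G\<lparr>carrier := H\<rparr>)"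
    and nc: "\<not> comm_group (G\<lparr>carrier := H\<rparr>)"
  shows "\<exists>r \<in> pOrd (carrier G). left_invariant G r \<and>
    \<not> (\<exists>M. borel_prob_on (Ext (carrier G) r) M \<and> L_invariant_measure G M)"
proof -
  obtain S where S: "freely_generates (G\<lparr>carrier := H\<rparr>) S"
    using free by (auto simp: free_group_def)
  interpret K: group "G\<lparr>carrier := H\<rparr>"
    using H by (rule subgroup_imp_group)
  obtain a b where aS: "a \<in> S" and bS: "b \<in> S" and ab: "a \<otimes> b \<noteq> b \<otimes> a"
    using K.noncommuting_free_generators[OF S nc] by auto
  have aH: "a \<in> H" and bH: "b \<in> H"
    using aS bS S by (auto simp: freely_generates_def)
  then have a: "a \<in> carrier G" and b: "b \<in> carrier G"
    using H by (auto dest: subgroup.mem_carrier)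
  have "a \<noteq> b"
    using ab by auto
  define P where "P = word_value (G\<lparr>carrier := H\<rparr>) ` cone_words a b"
  note cone = K.free_cone[OF S aS bS \<open>a \<noteq> b\<close>, folded P_def]
  have pow: "x [^]\<^bsub>G\<lparr>carrier := H\<rparr>\<^esub> n = x [^] n" for x and n :: nat
    by (simp add: nat_pow_def)
  have P_pow: "y \<otimes> a [^] n \<in> P" "y \<otimes> inv a [^] n \<in> P"
    if "y \<in> {b, inv b}" "n > 0" for y and n :: nat
    using cone(3,4)[of y n] that m_inv_consistent[OF H] aH bH by (auto simp: pow)
  let ?r = "cone_order G P"
  have rel: "?r (a [^] i \<otimes> y) (a [^] j)" if y: "y \<in> {b, inv b}" and ij: "i \<noteq> j" for y and i j :: nat
  proof -
    have yG: "y \<in> carrier G" and inv_y: "inv y \<in> {b, inv b}"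
      using y b by auto
    \<comment> \<open>With \<open>y = b\<^sup>\<plusminus>\<^sup>1\<close>, this quotient is \<open>b\<close> to the power \<open>\<mp>1\<close>, times \<open>a\<^sup>j\<^sup>-\<^sup>i\<close>.\<close>
    have "inv (a [^] i \<otimes> y) \<otimes> a [^] j = inv y \<otimes> (inv (a [^] i) \<otimes> a [^] j)"
      using a yG by (simp add: inv_mult_group m_assoc)
    also have "\<dots> \<in> P"
      using P_pow[OF inv_y] ij by (simp add: inv_pow_mult_pow[OF a])
    finally show ?thesis
      using a yG by (simp add: cone_order_def)
  qed
  have "?r \<in> pOrd (carrier G)"
    using cone(1,2) by (intro cone_order_in_pOrd) auto
  moreover have inv: "left_invariant G ?r"
    by (rule cone_order_left_invariant)
  moreover have False
    if M: "borel_prob_on (Ext (carrier G) ?r) M" "L_invariant_measure G M" for M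
  proof -
    have bound: "3 * measure M (ext_event G ?r \<one> y) \<le> 1" if "y \<in> {b, inv b}" for y
      using exclusive_events_bound[OF M inv, of y "{..<3::nat}" "\<lambda>i. a [^] i"] rel[OF that] that a b
      by auto
    have "b \<noteq> \<one>"
      using ab a by auto
    then show False
      using ext_event_inv[OF M inv b] bound[of b] bound[of "inv b"] by simp
  qed
  ultimately show ?thesis
    by blast
qed

theorem mainTheorem5:
  fixes G :: "('a, 'b) monoid_scheme"
  assumes "group G"
    and "\<exists>H. subgroup H G \<and> free_group (G\<lparr>carrier := H\<rparr>) \<and> \<not> comm_group (G\<lparr>carrier := H\<rparr>)"
  shows "\<exists>r \<in> pOrd (carrier G). left_invariant G r \<and>
    \<not> (\<exists>M. borel_prob_on (Ext (carrier G) r) M \<and> L_invariant_measure G M)"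
proof -
  obtain H where "subgroup H G" "free_group (G\<lparr>carrier := H\<rparr>)"
      "\<not> comm_group (G\<lparr>carrier := H\<rparr>)"
    using assms(2) by blast
  with assms(1) show ?thesis
    by (rule group.no_invariant_measure_of_free_subgroup)
qed

end
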